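(* For an integer $N\ge2$, real numbers $\gamma\in[1/\sqrt N,1]$ and $\delta\in(0,1)$, and an integer $t\ge0$ with $t=o(1/\gamma^2)$, every algorithm solving $\mathsf{frOR}_{N,\delta,t}$ (with overlap parameter $\gamma$) has cost $\Omega(\sqrt N/\delta)$. Precisely: for every sequence of parameters $(N_n,\gamma_n,\delta_n,t_n)_{n\ge1}$ with $N_n\ge 2$ an integer, $\gamma_n\in[1/\sqrt{N_n},1]$, $\delta_n\in(0,1)$, $t_n\ge 0$ an integer, and $t_n\gamma_n^2\to0$ as $n\to\infty$, there exist $c>0$ and $n_0$ such that for all $n\ge n_0$ every algorithm solving $\mathsf{frOR}_{N_n,\delta_n,t_n}$ with overlap parameter $\gamma_n$ has cost at least $c\sqrt{N_n}/\delta_n$.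
   Context: Model of computation. The input is an unknown $N$-dimensional unitary $U$. The state space is $\mathbb{C}^N\otimes W$, where the first register is $N$-dimensional with computational basis $|0\rangle,\dots,|N-1\rangle$ and $W$ is an arbitrarily large (finite-dimensional) workspace. The algorithm may apply $U$ and $U^{-1}$ to the first register (possibly controlled by a qubit of the workspace), and arbitrary unitaries independent of $U$ to the whole space; at the end it performs a POVM (independent of $U$) which determines the classical output. The starting state is the all-zero state together with the advice states described below. The cost of the algorithm is the total number of applications of $U$ and $U^{-1}$ (including controlled versions); all other operations are free. For $j\in\{0,\dots,N-1\}$ let $M_{j,\delta}=I-(1-e^{i\delta})|j\rangle\langle j|$. The task $\mathsf{frOR}_{N,\delta,t}$ (fractional OR with advice, with overlap parameter $\gamma$). Input promise: $U\in\{I\}\cup\{M_{j,\delta}:j\in\{1,\dots,N-1\}\}$. Advice: when $U=I$, part of the starting state consists of $t$ copies of $|0\rangle\in\mathbb{C}^N$; when $U=M_{j,\delta}$, part of the starting state is $(\gamma|j\rangle+\sqrt{1-\gamma^2}\,|0\rangle)^{\otimes t}$. Output: with probability at least $2/3$, output $1$ if $U=I$ and $0$ if $U\ne I$. *)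

theory Defs
  imports Complex_Main "Jordan_Normal_Form.Schur_Decomposition"
begin

section \<open>Tensor products\<close>

text \<open>The basis vector \<open>|i\<rangle> \<otimes> |k\<rangle>\<close> of \<open>\<complex>\<^sup>m \<otimes> \<complex>\<^sup>n\<close> has index \<open>i * n + k\<close>.\<close>

definition kron_vec :: "complex vec \<Rightarrow> complex vec \<Rightarrow> complex vec" (infixr \<open>\<otimes>\<^sub>v\<close> 72) where
  "v \<otimes>\<^sub>v w = vec (dim_vec v * dim_vec w) (\<lambda>i. v $ (i div dim_vec w) * w $ (i mod dim_vec w))"

definition kron_mat :: "complex mat \<Rightarrow> complex mat \<Rightarrow> complex mat" (infixr \<open>\<otimes>\<^sub>m\<close> 72) where
  "A \<otimes>\<^sub>m B = mat (dim_row A * dim_row B) (dim_col A * dim_col B)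
     (\<lambda>(i, j). A $$ (i div dim_row B, j div dim_col B) * B $$ (i mod dim_row B, j mod dim_col B))"

primrec vec_tensor_power :: "complex vec \<Rightarrow> nat \<Rightarrow> complex vec" where
  "vec_tensor_power v 0 = unit_vec 1 0"
| "vec_tensor_power v (Suc t) = v \<otimes>\<^sub>v vec_tensor_power v t"


section \<open>Unitaries and measurements\<close>

definition unitary_mat :: "nat \<Rightarrow> complex mat \<Rightarrow> bool" where
  "unitary_mat D V \<longleftrightarrow> V \<in> carrier_mat D D \<and>
     V * mat_adjoint V = 1\<^sub>m D \<and> mat_adjoint V * V = 1\<^sub>m D"

text \<open>In the order on \<^typ>\<open>complex\<close>, \<open>0 \<le> z\<close> means that \<open>z\<close> is real and nonnegative.\<close>

definition psd_mat :: "nat \<Rightarrow> complex mat \<Rightarrow> bool" where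
  "psd_mat D E \<longleftrightarrow> E \<in> carrier_mat D D \<and> (\<forall>v \<in> carrier_vec D. 0 \<le> (E *\<^sub>v v) \<bullet>c v)"

definition is_povm :: "nat \<Rightarrow> complex mat list \<Rightarrow> bool" where
  "is_povm D Es \<longleftrightarrow> (\<forall>E \<in> set Es. psd_mat D E) \<and> foldr (+) Es (0\<^sub>m D D) = 1\<^sub>m D"

definition basis_proj :: "nat \<Rightarrow> nat \<Rightarrow> complex mat" where
  "basis_proj n j = mat n n (\<lambda>(i, k). if i = j \<and> k = j then 1 else 0)"


section \<open>Query algorithms\<close>

text \<open>
  The state space is \<open>\<complex>\<^sup>N \<otimes> W\<close> with workspace
  \<open>W = (\<complex>\<^sup>N)\<^sup>\<otimes>\<^sup>t \<otimes> (\<complex>\<^sup>2)\<^sup>\<otimes>\<^sup>q \<otimes> \<complex>\<^sup>d\<close>. The first factor of \<open>W\<close> initially holds the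
  advice; the \<open>q\<close> qubits may serve as controls; \<open>q\<close> and \<open>d\<close> are chosen by the algorithm.
  In \<open>CQuery k\<close> and \<open>CQueryInv k\<close>, the number \<open>k\<close> is that of the control qubit.
\<close>

datatype step =
    Query
  | QueryInv
  | CQuery nat
  | CQueryInv nat
  | Free "complex mat"

text \<open>Outcome \<open>i\<close> of the final measurement (the POVM \<open>povm\<close>) produces the classical output \<open>out i\<close>.\<close>

record algorithm =
  qubits :: nat
  rest_dim :: nat
  steps :: "step list"
  povm :: "complex mat list"
  out :: "nat \<Rightarrow> nat"

definition work_dim :: "nat \<Rightarrow> nat \<Rightarrow> algorithm \<Rightarrow> nat" where
  "work_dim N t A = N ^ t * (2 ^ qubits A * rest_dim A)"

definition total_dim :: "nat \<Rightarrow> nat \<Rightarrow> algorithm \<Rightarrow> nat" where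
  "total_dim N t A = N * work_dim N t A"

fun valid_step :: "nat \<Rightarrow> nat \<Rightarrow> algorithm \<Rightarrow> step \<Rightarrow> bool" where
  "valid_step N t A (CQuery k) \<longleftrightarrow> k < qubits A"
| "valid_step N t A (CQueryInv k) \<longleftrightarrow> k < qubits A"
| "valid_step N t A (Free V) \<longleftrightarrow> unitary_mat (total_dim N t A) V"
| "valid_step N t A _ \<longleftrightarrow> True"

definition valid_algorithm :: "nat \<Rightarrow> nat \<Rightarrow> algorithm \<Rightarrow> bool" where
  "valid_algorithm N t A \<longleftrightarrow> 0 < rest_dim A \<and>
     (\<forall>s \<in> set (steps A). valid_step N t A s) \<and> is_povm (total_dim N t A) (povm A)"

text \<open>The projector onto value \<open>b\<close> of the \<open>k\<close>-th qubit, as an operator on the workspace.\<close>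

definition control_proj :: "nat \<Rightarrow> nat \<Rightarrow> algorithm \<Rightarrow> nat \<Rightarrow> nat \<Rightarrow> complex mat" where
  "control_proj N t A k b =
     1\<^sub>m (N ^ t * 2 ^ k) \<otimes>\<^sub>m basis_proj 2 b \<otimes>\<^sub>m 1\<^sub>m (2 ^ (qubits A - Suc k) * rest_dim A)"

definition query_mat :: "nat \<Rightarrow> nat \<Rightarrow> algorithm \<Rightarrow> complex mat \<Rightarrow> complex mat" where
  "query_mat N t A U = U \<otimes>\<^sub>m 1\<^sub>m (work_dim N t A)"

definition controlled_query_mat ::
    "nat \<Rightarrow> nat \<Rightarrow> algorithm \<Rightarrow> nat \<Rightarrow> complex mat \<Rightarrow> complex mat" where
  "controlled_query_mat N t A k U =
     1\<^sub>m N \<otimes>\<^sub>m control_proj N t A k 0 + U \<otimes>\<^sub>m control_proj N t A k 1"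

text \<open>The input \<open>U\<close> is unitary, so its inverse is its adjoint.\<close>

fun step_mat :: "nat \<Rightarrow> nat \<Rightarrow> algorithm \<Rightarrow> complex mat \<Rightarrow> step \<Rightarrow> complex mat" where
  "step_mat N t A U Query = query_mat N t A U"
| "step_mat N t A U QueryInv = query_mat N t A (mat_adjoint U)"
| "step_mat N t A U (CQuery k) = controlled_query_mat N t A k U"
| "step_mat N t A U (CQueryInv k) = controlled_query_mat N t A k (mat_adjoint U)"
| "step_mat N t A U (Free V) = V"

fun is_query :: "step \<Rightarrow> bool" where
  "is_query (Free V) \<longleftrightarrow> False"
| "is_query _ \<longleftrightarrow> True"

definition cost :: "algorithm \<Rightarrow> nat" where
  "cost A = length (filter is_query (steps A))"

text \<open>Here \<open>a\<close> is a single copy of the advice state.\<close>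

definition start_state :: "nat \<Rightarrow> nat \<Rightarrow> algorithm \<Rightarrow> complex vec \<Rightarrow> complex vec" where
  "start_state N t A a =
     unit_vec N 0 \<otimes>\<^sub>v vec_tensor_power a t \<otimes>\<^sub>v unit_vec (2 ^ qubits A * rest_dim A) 0"

definition final_state ::
    "nat \<Rightarrow> nat \<Rightarrow> algorithm \<Rightarrow> complex mat \<Rightarrow> complex vec \<Rightarrow> complex vec" where
  "final_state N t A U a =
     foldl (\<lambda>\<psi> s. step_mat N t A U s *\<^sub>v \<psi>) (start_state N t A a) (steps A)"

definition prob_output ::
    "nat \<Rightarrow> nat \<Rightarrow> algorithm \<Rightarrow> complex mat \<Rightarrow> complex vec \<Rightarrow> nat \<Rightarrow> real" where
  "prob_output N t A U a b =
     (let \<psi> = final_state N t A U a in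
        \<Sum>i \<in> {i. i < length (povm A) \<and> out A i = b}. Re ((povm A ! i *\<^sub>v \<psi>) \<bullet>c \<psi>))"


section \<open>Fractional OR with advice\<close>

definition frac_phase :: "nat \<Rightarrow> nat \<Rightarrow> real \<Rightarrow> complex mat" where
  "frac_phase N j \<delta> = 1\<^sub>m N - (1 - exp (\<i> * of_real \<delta>)) \<cdot>\<^sub>m basis_proj N j"

definition advice_state :: "nat \<Rightarrow> real \<Rightarrow> nat \<Rightarrow> complex vec" where
  "advice_state N \<gamma> j =
     of_real \<gamma> \<cdot>\<^sub>v unit_vec N j + of_real (sqrt (1 - \<gamma>\<^sup>2)) \<cdot>\<^sub>v unit_vec N 0"

definition solves_frOR :: "nat \<Rightarrow> real \<Rightarrow> nat \<Rightarrow> real \<Rightarrow> algorithm \<Rightarrow> bool" where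
  "solves_frOR N \<delta> t \<gamma> A \<longleftrightarrow> valid_algorithm N t A \<and>
     prob_output N t A (1\<^sub>m N) (unit_vec N 0) 1 \<ge> 2 / 3 \<and>
     (\<forall>j \<in> {1..N - 1}. prob_output N t A (frac_phase N j \<delta>) (advice_state N \<gamma> j) 0 \<ge> 2 / 3)"

end

theory Submission
  imports Defs "HOL-Analysis.L2_Norm"
begin

text \<open>
  Hybrid argument. Compare the run on \<open>U = I\<close> with the run on \<open>U = M\<^bsub>j,\<delta>\<^esub>\<close>. Every query, controlled
  or inverse, is a diagonal unitary that differs from the identity by at most \<open>\<delta>\<close> in each entry, and
  only on the block of \<open>|j\<rangle>\<close>. Hence the final states are at distance at most the distance of the
  starting states plus \<open>\<delta>\<close> times the sum, over the queries, of the amplitudes on \<open>|j\<rangle>\<close> in the run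
  on \<open>I\<close>. These amplitudes are square summable over \<open>j\<close> with sum at most \<open>1\<close>, so averaging over \<open>j\<close>
  bounds the second term by \<open>\<delta> T / \<surd>(N - 1)\<close> for some \<open>j\<close>. The overlap of the starting states is
  \<open>(1 - \<gamma>\<^sup>2)\<^bsup>t/2\<^esup> \<ge> 1 - t \<gamma>\<^sup>2\<close>, so the first term tends to \<open>0\<close>, whereas a successful measurement
  forces a constant distance at the end.
\<close>

section \<open>The Euclidean norm\<close>

text \<open>Phrased through \<open>L2_set\<close>, whose triangle and Cauchy-Schwarz inequalities
  then apply directly.\<close>

definition vnorm :: "complex vec \<Rightarrow> real" where
  "vnorm v = L2_set (\<lambda>i. cmod (v $ i)) {..<dim_vec v}"

lemma vnorm_nonneg: "0 \<le> vnorm v"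
  by (simp add: vnorm_def)

lemma vnorm_power2_eq_sum: "(vnorm v)\<^sup>2 = (\<Sum>i<dim_vec v. (cmod (v $ i))\<^sup>2)"
  by (simp add: vnorm_def L2_set_def sum_nonneg)

lemma cscalar_prod_eq_sum:
  fixes v w :: "complex vec"
  shows "v \<bullet>c w = (\<Sum>i<dim_vec w. v $ i * cnj (w $ i))"
  by (simp add: scalar_prod_def atLeast0LessThan)

lemma cscalar_prod_self:
  fixes v :: "complex vec"
  shows "v \<bullet>c v = of_real ((vnorm v)\<^sup>2)"
  by (simp add: cscalar_prod_eq_sum vnorm_power2_eq_sum complex_norm_square del: of_real_power)

lemma vnorm_add_le:
  assumes "dim_vec u = dim_vec v"
  shows "vnorm (u + v) \<le> vnorm u + vnorm v"
proof -
  have "vnorm (u + v) \<le> L2_set (\<lambda>i. cmod (u $ i) + cmod (v $ i)) {..<dim_vec v}"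
    unfolding vnorm_def by (auto intro!: L2_set_mono norm_triangle_ineq)
  also have "\<dots> \<le> vnorm u + vnorm v"
    using assms L2_set_triangle_ineq[of "\<lambda>i. cmod (u $ i)" "\<lambda>i. cmod (v $ i)" "{..<dim_vec v}"]
    by (simp add: vnorm_def)
  finally show ?thesis .
qed

section \<open>Adjoints and unitary matrices\<close>

lemma mat_adjoint_index:
  assumes "i < dim_col A" "k < dim_row A"
  shows "mat_adjoint A $$ (i, k) = conjugate (A $$ (k, i))"
  using assms by (simp add: mat_adjoint_def mat_of_rows_def)

lemma mat_adjoint_carrier:
  "A \<in> carrier_mat m n \<Longrightarrow> mat_adjoint A \<in> carrier_mat n m"
  by (intro carrier_matI) (simp_all add: mat_adjoint_def)

lemma cscalar_prod_mult_mat_vec: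
  fixes A :: "complex mat"
  assumes A: "A \<in> carrier_mat m n" and v: "v \<in> carrier_vec n" and w: "w \<in> carrier_vec m"
  shows "(A *\<^sub>v v) \<bullet>c w = v \<bullet>c (mat_adjoint A *\<^sub>v w)"
proof -
  have "(A *\<^sub>v v) \<bullet>c w = (\<Sum>i<m. \<Sum>k<n. A $$ (i, k) * v $ k * cnj (w $ i))"
    using A v w unfolding cscalar_prod_eq_sum
    by (auto simp: scalar_prod_def atLeast0LessThan sum_distrib_right intro!: sum.cong)
  also have "\<dots> = (\<Sum>k<n. \<Sum>i<m. A $$ (i, k) * v $ k * cnj (w $ i))"
    by (rule sum.swap)
  also have "\<dots> = v \<bullet>c (mat_adjoint A *\<^sub>v w)"
    using A v w mat_adjoint_carrier[OF A] unfolding cscalar_prod_eq_sum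
    by (auto simp: scalar_prod_def atLeast0LessThan sum_distrib_left mat_adjoint_index
        cnj_sum ac_simps intro!: sum.cong)
  finally show ?thesis .
qed

lemma vnorm_unitary_mult:
  assumes V: "unitary_mat D V" and v: "v \<in> carrier_vec D"
  shows "vnorm (V *\<^sub>v v) = vnorm v"
proof -
  have c: "V \<in> carrier_mat D D" and inv: "mat_adjoint V * V = 1\<^sub>m D"
    using V by (auto simp: unitary_mat_def)
  have "(V *\<^sub>v v) \<bullet>c (V *\<^sub>v v) = v \<bullet>c (mat_adjoint V *\<^sub>v (V *\<^sub>v v))"
    using c v by (intro cscalar_prod_mult_mat_vec) auto
  also have "mat_adjoint V *\<^sub>v (V *\<^sub>v v) = v"
    using assoc_mult_mat_vec[OF mat_adjoint_carrier[OF c] c v] inv v by simp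
  finally have "(vnorm (V *\<^sub>v v))\<^sup>2 = (vnorm v)\<^sup>2"
    unfolding cscalar_prod_self of_real_eq_iff .
  thus ?thesis by (simp add: vnorm_nonneg)
qed


section \<open>Diagonal matrices\<close>

text \<open>The entries are given by a function on all naturals, so that products and sums of
  diagonal matrices become pointwise expressions in the index.\<close>

definition diag_entries :: "nat \<Rightarrow> complex mat \<Rightarrow> (nat \<Rightarrow> complex) \<Rightarrow> bool" where
  "diag_entries n M a \<longleftrightarrow> M \<in> carrier_mat n n \<and>
     (\<forall>i<n. \<forall>k<n. M $$ (i, k) = (if i = k then a i else 0))"

lemma diag_entries_mult_vec:
  assumes "diag_entries n M a" "v \<in> carrier_vec n"
  shows "M *\<^sub>v v = vec n (\<lambda>i. a i * v $ i)"
proof (rule eq_vecI)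
  fix i assume i: "i < dim_vec (vec n (\<lambda>i. a i * v $ i))"
  have "(M *\<^sub>v v) $ i = (\<Sum>k<n. (if k = i then a i * v $ i else 0))"
    using assms i
    by (auto simp: diag_entries_def scalar_prod_def atLeast0LessThan
        simp del: sum.delta sum.delta' intro!: sum.cong)
  thus "(M *\<^sub>v v) $ i = vec n (\<lambda>i. a i * v $ i) $ i"
    using i by simp
qed (use assms in \<open>auto simp: diag_entries_def\<close>)

lemma diag_entries_one: "diag_entries n (1\<^sub>m n) (\<lambda>_. 1)"
  by (auto simp: diag_entries_def)

lemma diag_entries_basis_proj: "diag_entries n (basis_proj n j) (\<lambda>i. if i = j then 1 else 0)"
  by (auto simp: diag_entries_def basis_proj_def)

lemma diag_entries_frac_phase:
  "diag_entries n (frac_phase n j \<delta>) (\<lambda>i. if i = j then exp (\<i> * of_real \<delta>) else 1)"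
  by (auto simp: diag_entries_def basis_proj_def frac_phase_def)

lemma diag_entries_add:
  "diag_entries n A a \<Longrightarrow> diag_entries n B b \<Longrightarrow> diag_entries n (A + B) (\<lambda>i. a i + b i)"
  by (auto simp: diag_entries_def)

lemma diag_entries_mat_adjoint:
  "diag_entries n A a \<Longrightarrow> diag_entries n (mat_adjoint A) (\<lambda>i. cnj (a i))"
  by (auto simp: diag_entries_def mat_adjoint_index mat_adjoint_carrier)

lemma mod_less_of_less_mult: "i < m * n \<Longrightarrow> i mod n < n" for i m n :: nat
  by (cases n) auto

lemma diag_entries_kron:
  assumes "diag_entries m A a" "diag_entries n B b"
  shows "diag_entries (m * n) (A \<otimes>\<^sub>m B) (\<lambda>i. a (i div n) * b (i mod n))"
proof -
  \<comment> \<open>Quotient and remainder determine the index, so the product of the two Kronecker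
    deltas is a single one.\<close>
  have eq: "i div n = k div n \<and> i mod n = k mod n \<longleftrightarrow> i = k" for i k
    by (metis div_mult_mod_eq)
  have "A $$ (i div n, k div n) * B $$ (i mod n, k mod n) =
      (if i = k then a (i div n) * b (i mod n) else 0)" if "i < m * n" "k < m * n" for i k
  proof -
    have "A $$ (i div n, k div n) * B $$ (i mod n, k mod n) =
        (if i div n = k div n \<and> i mod n = k mod n then a (i div n) * b (i mod n) else 0)"
      using assms that by (simp add: diag_entries_def less_mult_imp_div_less mod_less_of_less_mult)
    thus ?thesis by (simp only: eq)
  qed
  moreover have "A \<in> carrier_mat m m" "B \<in> carrier_mat n n"
    using assms by (simp_all add: diag_entries_def)
  ultimately show ?thesis
    by (simp add: diag_entries_def kron_mat_def)
qed


section \<open>Action of a query\<close>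

lemma diag_entries_control_proj:
  assumes "k < qubits A"
  shows "\<exists>\<beta>. (\<forall>i. \<beta> i < (2::nat)) \<and>
    (\<forall>b. diag_entries (work_dim N t A) (control_proj N t A k b) (\<lambda>i. if \<beta> i = b then 1 else 0))"
proof (cases "rest_dim A = 0")
  case True
  hence "\<forall>b. diag_entries (work_dim N t A) (control_proj N t A k b) (\<lambda>i. if 0 = b then 1 else 0)"
    by (auto simp: diag_entries_def work_dim_def control_proj_def kron_mat_def)
  thus ?thesis by (intro exI[of _ "\<lambda>_. 0"]) auto
next
  case False
  define X where "X = 2 ^ (qubits A - Suc k) * rest_dim A"
  define \<beta> where "\<beta> i = (i mod (2 * X)) div X" for i
  have X: "X > 0" using False by (simp add: X_def)
  have "(2::nat) ^ qubits A = 2 ^ k * (2 * 2 ^ (qubits A - Suc k))"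
    using power_add[of "2::nat" k "Suc (qubits A - Suc k)"] assms by simp
  hence W: "work_dim N t A = N ^ t * 2 ^ k * (2 * X)"
    by (simp add: work_dim_def X_def)
  have "diag_entries (work_dim N t A) (control_proj N t A k b) (\<lambda>i. if \<beta> i = b then 1 else 0)" for b
    using diag_entries_kron[OF diag_entries_one[of "N ^ t * 2 ^ k"]
        diag_entries_kron[OF diag_entries_basis_proj[of 2 b] diag_entries_one[of X]]]
    by (simp add: control_proj_def W \<beta>_def flip: X_def)
  moreover have "\<beta> i < 2" for i
    unfolding \<beta>_def using X by (intro less_mult_imp_div_less) simp
  ultimately show ?thesis by blast
qed

text \<open>A chord is no longer than its arc: the left side equals 2|sin(x/2)|.\<close>

lemma cmod_exp_i_minus_one_le: "cmod (exp (\<i> * of_real x) - 1) \<le> \<bar>x\<bar>"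
proof -
  have "(cmod (exp (\<i> * of_real x) - 1))\<^sup>2 = (cos x - 1)\<^sup>2 + (sin x)\<^sup>2"
    by (simp add: cmod_power2 Re_exp Im_exp)
  also have "\<dots> = 2 - 2 * cos x"
    using sin_cos_squared_add[of x] by (simp add: power2_eq_square algebra_simps)
  also have "\<dots> = 4 * (sin (x / 2))\<^sup>2"
    using cos_double_sin[of "x / 2"] by simp
  also have "\<dots> \<le> 4 * (x / 2)\<^sup>2"
    using abs_sin_x_le_abs_x[of "x / 2"] by (simp only: abs_le_square_iff)
  also have "\<dots> = \<bar>x\<bar>\<^sup>2" by (simp add: power2_eq_square)
  finally show ?thesis by (rule power2_le_imp_le) simp
qed

text \<open>Since \<open>i div work_dim N t A\<close> is the basis state of the first register, the
  bound forces \<open>c i = 1\<close> outside the block of \<open>j\<close>. Modulus 1 will give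
  norm preservation.\<close>

lemma diag_entries_query:
  assumes s: "is_query s" "valid_step N t A s"
  shows "\<exists>c. diag_entries (total_dim N t A) (step_mat N t A (frac_phase N j \<delta>) s) c \<and>
    (\<forall>i. cmod (c i) = 1 \<and> cmod (c i - 1) \<le> (if i div work_dim N t A = j then \<bar>\<delta>\<bar> else 0))"
proof -
  define W where "W = work_dim N t A"
  have tot: "total_dim N t A = N * W" by (simp add: total_dim_def W_def)
  define e where "e = exp (\<i> * of_real \<delta>)"
  have e: "cmod e = 1" "cmod (e - 1) \<le> \<bar>\<delta>\<bar>"
    using cmod_exp_i_minus_one_le by (auto simp: e_def)
  have e': "cmod (cnj e) = 1" "cmod (cnj e - 1) \<le> \<bar>\<delta>\<bar>"
    using e complex_mod_cnj[of "e - 1"] by auto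
  \<comment> \<open>A general phase \<open>z\<close> covers both the input, with
    \<open>z = e\<close>, and its inverse, with \<open>z = cnj e\<close>.\<close>
  have main: "\<exists>c. diag_entries (N * W) M c \<and>
      (\<forall>i. cmod (c i) = 1 \<and> cmod (c i - 1) \<le> (if i div W = j then \<bar>\<delta>\<bar> else 0))"
    if u: "diag_entries N U (\<lambda>i. if i = j then z else 1)" "cmod z = 1" "cmod (z - 1) \<le> \<bar>\<delta>\<bar>"
      and M: "M = query_mat N t A U \<or> (\<exists>k<qubits A. M = controlled_query_mat N t A k U)"
    for U z M
    using M
  proof
    assume M: "M = query_mat N t A U"
    show ?thesis
      using diag_entries_kron[OF u(1) diag_entries_one[of W]] u(2,3)
      by (intro exI[of _ "\<lambda>i. (if i div W = j then z else 1) * 1"]) (auto simp: M query_mat_def W_def)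
  next
    assume "\<exists>k<qubits A. M = controlled_query_mat N t A k U"
    then obtain k where k: "k < qubits A" and M: "M = controlled_query_mat N t A k U" by blast
    obtain \<beta> where \<beta>: "\<And>i. \<beta> i < (2::nat)"
      "\<And>b. diag_entries W (control_proj N t A k b) (\<lambda>i. if \<beta> i = b then 1 else 0)"
      using diag_entries_control_proj[OF k, of N t] unfolding W_def by blast
    let ?c = "\<lambda>i. 1 * (if \<beta> (i mod W) = 0 then 1 else 0) +
       (if i div W = j then z else 1) * (if \<beta> (i mod W) = 1 then 1 else 0)"
    have "diag_entries (N * W) M ?c"
      unfolding M controlled_query_mat_def
      by (intro diag_entries_add diag_entries_kron diag_entries_one u(1) \<beta>(2))
    moreover have "cmod (?c i) = 1 \<and> cmod (?c i - 1) \<le> (if i div W = j then \<bar>\<delta>\<bar> else 0)" for i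
    proof -
      have "\<beta> (i mod W) = 0 \<or> \<beta> (i mod W) = 1" using \<beta>(1)[of "i mod W"] by linarith
      thus ?thesis using u(2,3) by auto
    qed
    ultimately show ?thesis by blast
  qed
  have "diag_entries N (mat_adjoint (frac_phase N j \<delta>)) (\<lambda>i. if i = j then cnj e else 1)"
    using diag_entries_mat_adjoint[OF diag_entries_frac_phase[of N j \<delta>]]
    by (simp add: if_distrib e_def cong: if_cong)
  note inv = main[OF this e']
  note fwd = main[OF diag_entries_frac_phase[of N j \<delta>, folded e_def] e]
  show ?thesis
    unfolding tot W_def[symmetric]
    using s by (cases s) (simp_all only: is_query.simps valid_step.simps step_mat.simps, (blast intro: fwd inv)+)
qed

section \<open>The projection |j><j| tensor identity and its summability over
  \<open>j\<close>\<close>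

definition block_proj :: "nat \<Rightarrow> nat \<Rightarrow> complex vec \<Rightarrow> complex vec" where
  "block_proj W j v = vec (dim_vec v) (\<lambda>i. if i div W = j then v $ i else 0)"

text \<open>Blocks for distinct \<open>j\<close> are disjoint: after swapping the sums, each index
  is counted at most once.\<close>

lemma sum_vnorm_block_proj_power2_le:
  assumes "finite S"
  shows "(\<Sum>j\<in>S. (vnorm (block_proj W j v))\<^sup>2) \<le> (vnorm v)\<^sup>2"
proof -
  have "(\<Sum>j\<in>S. (vnorm (block_proj W j v))\<^sup>2) =
      (\<Sum>j\<in>S. \<Sum>i<dim_vec v. if i div W = j then (cmod (v $ i))\<^sup>2 else 0)"
    unfolding vnorm_power2_eq_sum by (auto simp: block_proj_def intro!: sum.cong)
  also have "\<dots> = (\<Sum>i<dim_vec v. \<Sum>j\<in>S. if i div W = j then (cmod (v $ i))\<^sup>2 else 0)"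
    by (rule sum.swap)
  also have "\<dots> \<le> (vnorm v)\<^sup>2"
    unfolding vnorm_power2_eq_sum using assms by (intro sum_mono) (simp add: sum.delta')
  finally show ?thesis .
qed

text \<open>Cauchy-Schwarz against the constant 1. This is the source of the square root of
  \<open>N\<close> in the final bound.\<close>

lemma sum_vnorm_block_proj_le:
  assumes "finite S"
  shows "(\<Sum>j\<in>S. vnorm (block_proj W j v)) \<le> sqrt (card S) * vnorm v"
proof -
  have "(\<Sum>j\<in>S. vnorm (block_proj W j v)) \<le> sqrt (card S) * L2_set (\<lambda>j. vnorm (block_proj W j v)) S"
    using L2_set_mult_ineq[of "\<lambda>_. 1" "\<lambda>j. vnorm (block_proj W j v)" S]
    by (simp add: vnorm_nonneg L2_set_def)
  also have "\<dots> \<le> sqrt (card S) * vnorm v"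
    using sum_vnorm_block_proj_power2_le[OF assms, of W v]
    by (intro mult_left_mono) (auto simp: L2_set_def intro!: real_le_lsqrt sum_nonneg vnorm_nonneg)
  finally show ?thesis .
qed

text \<open>Makes the identity input the case \<open>\<delta> = 0\<close>, so that facts about
  \<open>frac_phase\<close> also cover it.\<close>

lemma frac_phase_zero: "frac_phase N j 0 = 1\<^sub>m N"
  by (rule eq_matI) (auto simp: frac_phase_def basis_proj_def)

section \<open>Effect of a single step on norms and distances\<close>

lemma step_mat_carrier:
  assumes "valid_step N t A s"
  shows "step_mat N t A (frac_phase N j \<delta>) s \<in> carrier_mat (total_dim N t A) (total_dim N t A)"
proof (cases "is_query s")
  case True
  thus ?thesis using diag_entries_query[OF True assms, of j \<delta>] by (auto simp: diag_entries_def)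
next
  case False
  thus ?thesis using assms by (cases s) (auto simp: unitary_mat_def)
qed

lemma query_identity:
  assumes "is_query s" "valid_step N t A s" "v \<in> carrier_vec (total_dim N t A)"
  shows "step_mat N t A (1\<^sub>m N) s *\<^sub>v v = v"
proof -
  obtain c where c: "diag_entries (total_dim N t A) (step_mat N t A (1\<^sub>m N) s) c"
    "\<And>i. cmod (c i - 1) \<le> (if i div work_dim N t A = 0 then \<bar>0\<bar> else 0)"
    using diag_entries_query[OF assms(1,2), of 0 0] unfolding frac_phase_zero by blast
  have "c i = 1" for i using c(2)[of i] by (simp split: if_splits)
  thus ?thesis using diag_entries_mult_vec[OF c(1) assms(3)] assms(3) by auto
qed

lemma vnorm_step_mat:
  assumes "valid_step N t A s" "v \<in> carrier_vec (total_dim N t A)"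
  shows "vnorm (step_mat N t A (frac_phase N j \<delta>) s *\<^sub>v v) = vnorm v"
proof (cases "is_query s")
  case True
  obtain c where c: "diag_entries (total_dim N t A) (step_mat N t A (frac_phase N j \<delta>) s) c"
    "\<And>i. cmod (c i) = 1"
    using diag_entries_query[OF True assms(1), of j \<delta>] by blast
  show ?thesis
    using assms(2) unfolding diag_entries_mult_vec[OF c(1) assms(2)] vnorm_def
    by (auto simp: norm_mult c(2) intro!: L2_set_cong)
next
  case False
  thus ?thesis using assms vnorm_unitary_mult by (cases s) auto
qed

text \<open>The difference has entries \<open>(c i - 1) * v $ i\<close>, which vanish outside the
  block of \<open>j\<close>.\<close>

lemma vnorm_query_diff_le:
  assumes "is_query s" "valid_step N t A s" "v \<in> carrier_vec (total_dim N t A)"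
  shows "vnorm (step_mat N t A (frac_phase N j \<delta>) s *\<^sub>v v - v)
           \<le> \<bar>\<delta>\<bar> * vnorm (block_proj (work_dim N t A) j v)"
proof -
  let ?W = "work_dim N t A"
  obtain c where c: "diag_entries (total_dim N t A) (step_mat N t A (frac_phase N j \<delta>) s) c"
    "\<And>i. cmod (c i - 1) \<le> (if i div ?W = j then \<bar>\<delta>\<bar> else 0)"
    using diag_entries_query[OF assms(1,2), of j \<delta>] by blast
  have "cmod (c i * x - x) \<le> \<bar>\<delta>\<bar> * cmod (if i div ?W = j then x else 0)" for i x
  proof -
    have "cmod (c i * x - x) = cmod (c i - 1) * cmod x"
      by (simp add: algebra_simps flip: norm_mult)
    thus ?thesis using mult_right_mono[OF c(2)[of i], of "cmod x"] by (auto split: if_splits)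
  qed
  hence "vnorm (step_mat N t A (frac_phase N j \<delta>) s *\<^sub>v v - v)
      \<le> L2_set (\<lambda>i. \<bar>\<delta>\<bar> * cmod (block_proj ?W j v $ i)) {..<total_dim N t A}"
    using assms(3) unfolding diag_entries_mult_vec[OF c(1) assms(3)] vnorm_def
    by (auto simp: block_proj_def intro!: L2_set_mono)
  thus ?thesis
    using assms(3) by (simp add: vnorm_def L2_set_right_distrib block_proj_def)
qed


section \<open>The hybrid argument\<close>

text \<open>Start vector and step list are arguments, so that inductions can generalize over both;
  \<open>final_state\<close> is the instance for the whole algorithm.\<close>

definition run :: "nat \<Rightarrow> nat \<Rightarrow> algorithm \<Rightarrow> complex mat \<Rightarrow> step list \<Rightarrow> complex vec \<Rightarrow> complex vec" where
  "run N t A U ss v = foldl (\<lambda>\<psi> s. step_mat N t A U s *\<^sub>v \<psi>) v ss"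

text \<open>The total amplitude with which the queries of the run on the identity touch \<open>|j\<rangle>\<close>.\<close>

primrec query_weight :: "nat \<Rightarrow> nat \<Rightarrow> algorithm \<Rightarrow> nat \<Rightarrow> step list \<Rightarrow> complex vec \<Rightarrow> real" where
  "query_weight N t A j [] v = 0"
| "query_weight N t A j (s # ss) v =
     (if is_query s then vnorm (block_proj (work_dim N t A) j v) else 0) +
     query_weight N t A j ss (step_mat N t A (1\<^sub>m N) s *\<^sub>v v)"

lemma run_carrier:
  assumes "\<forall>s\<in>set ss. valid_step N t A s" "v \<in> carrier_vec (total_dim N t A)"
  shows "run N t A (frac_phase N j \<delta>) ss v \<in> carrier_vec (total_dim N t A)"
  using assms
proof (induction ss arbitrary: v)
  case (Cons s ss)
  thus ?case using mult_mat_vec_carrier[OF step_mat_carrier[of N t A s j \<delta>]] by (simp add: run_def)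
qed (simp add: run_def)

lemma vnorm_run:
  assumes "\<forall>s\<in>set ss. valid_step N t A s" "v \<in> carrier_vec (total_dim N t A)"
  shows "vnorm (run N t A (frac_phase N j \<delta>) ss v) = vnorm v"
  using assms
proof (induction ss arbitrary: v)
  case (Cons s ss)
  thus ?case using mult_mat_vec_carrier[OF step_mat_carrier[of N t A s j \<delta>]]
    by (simp add: run_def vnorm_step_mat)
qed (simp add: run_def)

text \<open>At a query, \<open>U w - v = U (w - v) + (U v - v)\<close>. The first term keeps the
  norm of \<open>w - v\<close>; the second is charged to \<open>v\<close>, the state of the identity
  run, which is the same for all \<open>j\<close>. That makes the weights summable over
  \<open>j\<close>.\<close>

lemma vnorm_run_diff_le:
  assumes "\<forall>s\<in>set ss. valid_step N t A s"
    and "v \<in> carrier_vec (total_dim N t A)" "w \<in> carrier_vec (total_dim N t A)"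
  shows "vnorm (run N t A (frac_phase N j \<delta>) ss w - run N t A (1\<^sub>m N) ss v)
           \<le> vnorm (w - v) + \<bar>\<delta>\<bar> * query_weight N t A j ss v"
  using assms
proof (induction ss arbitrary: v w)
  case (Cons s ss)
  let ?D = "total_dim N t A"
  let ?U = "step_mat N t A (frac_phase N j \<delta>) s" and ?I = "step_mat N t A (1\<^sub>m N) s"
  have s: "valid_step N t A s" and v: "v \<in> carrier_vec ?D" and w: "w \<in> carrier_vec ?D"
    using Cons.prems by auto
  have U: "?U \<in> carrier_mat ?D ?D" and I: "?I \<in> carrier_mat ?D ?D"
    using step_mat_carrier[OF s] step_mat_carrier[OF s, of 0 0] by (simp_all add: frac_phase_zero)
  have step: "vnorm (?U *\<^sub>v w - ?I *\<^sub>v v) \<le> vnorm (w - v) +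
      \<bar>\<delta>\<bar> * (if is_query s then vnorm (block_proj (work_dim N t A) j v) else 0)"
  proof -
    have Uwv: "vnorm (?U *\<^sub>v (w - v)) = vnorm (w - v)"
      using vnorm_step_mat[OF s] v w by simp
    show ?thesis
    proof (cases "is_query s")
      case True
      have "?U *\<^sub>v w - ?I *\<^sub>v v = ?U *\<^sub>v (w - v) + (?U *\<^sub>v v - v)"
        using U v w query_identity[OF True s v] by (auto simp: mult_minus_distrib_mat_vec)
      hence "vnorm (?U *\<^sub>v w - ?I *\<^sub>v v) \<le> vnorm (?U *\<^sub>v (w - v)) + vnorm (?U *\<^sub>v v - v)"
        using U v by (auto intro!: vnorm_add_le)
      thus ?thesis using Uwv vnorm_query_diff_le[OF True s v, of j \<delta>] True by simp
    next
      case False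
      \<comment> \<open>A free step does not depend on the input.\<close>
      hence "?I = ?U" by (cases s) auto
      hence "?U *\<^sub>v w - ?I *\<^sub>v v = ?U *\<^sub>v (w - v)"
        using U v w by (simp add: mult_minus_distrib_mat_vec)
      thus ?thesis using Uwv False by simp
    qed
  qed
  have "vnorm (run N t A (frac_phase N j \<delta>) (s # ss) w - run N t A (1\<^sub>m N) (s # ss) v)
      \<le> vnorm (?U *\<^sub>v w - ?I *\<^sub>v v) + \<bar>\<delta>\<bar> * query_weight N t A j ss (?I *\<^sub>v v)"
    using Cons.IH[of "?I *\<^sub>v v" "?U *\<^sub>v w"] Cons.prems(1) U I v w by (simp add: run_def)
  also have "\<dots> \<le> vnorm (w - v) + \<bar>\<delta>\<bar> * query_weight N t A j (s # ss) v"
    using step by (simp add: distrib_left)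
  finally show ?case .
qed (simp add: run_def)

text \<open>Each query adds at most \<open>sqrt (card S)\<close> times the norm of the current
  state, and that norm is the same throughout the run.\<close>

lemma sum_query_weight_le:
  assumes "\<forall>s\<in>set ss. valid_step N t A s" "v \<in> carrier_vec (total_dim N t A)" "finite S"
  shows "(\<Sum>j\<in>S. query_weight N t A j ss v)
           \<le> real (length (filter is_query ss)) * (sqrt (card S) * vnorm v)"
  using assms
proof (induction ss arbitrary: v)
  case (Cons s ss)
  let ?I = "step_mat N t A (1\<^sub>m N) s"
  have s: "valid_step N t A s" using Cons.prems by auto
  have I: "?I *\<^sub>v v \<in> carrier_vec (total_dim N t A)"
    using step_mat_carrier[OF s, of 0 0] Cons.prems(2) by (simp add: frac_phase_zero)
  have n: "vnorm (?I *\<^sub>v v) = vnorm v"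
    using vnorm_step_mat[OF s Cons.prems(2), of 0 0] by (simp add: frac_phase_zero)
  have IH: "(\<Sum>j\<in>S. query_weight N t A j ss (?I *\<^sub>v v))
           \<le> real (length (filter is_query ss)) * (sqrt (card S) * vnorm v)"
    using Cons.IH[OF _ I] Cons.prems n by simp
  show ?case
    using IH sum_vnorm_block_proj_le[OF Cons.prems(3), of "work_dim N t A" v]
    by (auto simp: sum.distrib algebra_simps)
qed simp


section \<open>The starting state\<close>

text \<open>The index encoding of a pair turns a double sum into a single one; it gives the product
  rule for inner products of tensors.\<close>

lemma sum_div_mod:
  fixes f g :: "nat \<Rightarrow> 'a::comm_semiring_0"
  shows "(\<Sum>i<m * n. f (i div n) * g (i mod n)) = (\<Sum>a<m. f a) * (\<Sum>b<n. g b)"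
proof -
  have "(\<Sum>i<m * n. f (i div n) * g (i mod n)) = (\<Sum>(a, b)\<in>{..<m} \<times> {..<n}. f a * g b)"
  proof (rule sum.reindex_bij_witness[of _ "\<lambda>(a, b). a * n + b" "\<lambda>i. (i div n, i mod n)"])
    fix p assume "p \<in> {..<m} \<times> {..<n}"
    then obtain a b where p: "p = (a, b)" "a < m" "b < n" by auto
    have "a * n + b < Suc a * n" using p by simp
    also have "\<dots> \<le> m * n" using p by (intro mult_right_mono) auto
    finally show "(case p of (a, b) \<Rightarrow> a * n + b) \<in> {..<m * n}" using p by simp
  qed (auto simp: less_mult_imp_div_less mod_less_of_less_mult)
  thus ?thesis by (simp add: sum_product sum.cartesian_product)
qed

lemma dim_kron_vec [simp]: "dim_vec (v \<otimes>\<^sub>v w) = dim_vec v * dim_vec w"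
  by (simp add: kron_vec_def)

lemma cscalar_prod_kron:
  assumes "dim_vec v' = dim_vec v" "dim_vec w' = dim_vec w"
  shows "(v \<otimes>\<^sub>v w) \<bullet>c (v' \<otimes>\<^sub>v w') = (v \<bullet>c v') * (w \<bullet>c w')"
  unfolding cscalar_prod_eq_sum dim_kron_vec sum_div_mod[symmetric]
  using assms by (auto simp: kron_vec_def ac_simps intro!: sum.cong)

lemma dim_vec_tensor_power [simp]: "dim_vec (vec_tensor_power v t) = dim_vec v ^ t"
  by (induction t) auto

lemma cscalar_prod_unit_vec_self: "i < n \<Longrightarrow> unit_vec n i \<bullet>c unit_vec n i = (1 :: complex)"
  by (simp add: cscalar_prod_eq_sum unit_vec_def if_distrib cong: if_cong)

lemma cscalar_prod_tensor_power:
  "dim_vec v = dim_vec w \<Longrightarrow>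
     vec_tensor_power v t \<bullet>c vec_tensor_power w t = (v \<bullet>c w) ^ t"
  by (induction t) (auto simp: cscalar_prod_kron cscalar_prod_unit_vec_self)

lemma start_state_carrier:
  "dim_vec a = N \<Longrightarrow> start_state N t A a \<in> carrier_vec (total_dim N t A)"
  by (intro carrier_vecI) (simp add: start_state_def total_dim_def work_dim_def)

text \<open>Inner products multiply across tensor factors, and the fixed all-zero registers
  contribute 1.\<close>

lemma cscalar_prod_start_state:
  assumes "dim_vec a = N" "dim_vec b = N" "0 < N" "0 < rest_dim A"
  shows "start_state N t A a \<bullet>c start_state N t A b = (a \<bullet>c b) ^ t"
  using assms
  by (simp add: start_state_def cscalar_prod_kron cscalar_prod_tensor_power cscalar_prod_unit_vec_self)

lemma vnorm_start_state:
  assumes "dim_vec a = N" "0 < N" "0 < rest_dim A" "vnorm a = 1"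
  shows "vnorm (start_state N t A a) = 1"
proof -
  have "(vnorm (start_state N t A a))\<^sup>2 = 1"
    using cscalar_prod_start_state[OF assms(1,1,2,3), of t] assms(4)
    unfolding cscalar_prod_self by (simp flip: of_real_power)
  thus ?thesis using vnorm_nonneg[of "start_state N t A a"] by (simp add: power2_eq_1_iff)
qed

lemma vnorm_diff_power2:
  assumes "dim_vec v = dim_vec w"
  shows "(vnorm (v - w))\<^sup>2 = (vnorm v)\<^sup>2 + (vnorm w)\<^sup>2 - 2 * Re (v \<bullet>c w)"
proof -
  have "(cmod (x - y))\<^sup>2 = (cmod x)\<^sup>2 + (cmod y)\<^sup>2 - 2 * Re (x * cnj y)" for x y
    unfolding cmod_power2 by (simp add: power2_eq_square algebra_simps)
  thus ?thesis
    using assms unfolding vnorm_power2_eq_sum cscalar_prod_eq_sum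
    by (simp add: sum.distrib sum_subtractf sum_distrib_left)
qed

lemma vnorm_unit_vec: "i < n \<Longrightarrow> vnorm (unit_vec n i) = 1"
  using cscalar_prod_unit_vec_self[of i n] vnorm_nonneg[of "unit_vec n i"]
  unfolding cscalar_prod_self by (simp add: power2_eq_1_iff flip: of_real_power)

section \<open>Advice states and the distance of the starting states\<close>

lemma dim_advice_state [simp]: "dim_vec (advice_state N \<gamma> j) = N"
  by (simp add: advice_state_def)

lemma advice_state_overlap:
  assumes "j \<in> {1..N - 1}"
  shows "advice_state N \<gamma> j \<bullet>c unit_vec N 0 = of_real (sqrt (1 - \<gamma>\<^sup>2))"
proof -
  have "advice_state N \<gamma> j \<bullet>c unit_vec N 0 =
      (\<Sum>i<N. if i = 0 then complex_of_real (sqrt (1 - \<gamma>\<^sup>2)) else 0)"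
    using assms unfolding cscalar_prod_eq_sum
    by (intro sum.cong) (auto simp: advice_state_def unit_vec_def)
  moreover have "0 < N" using assms by auto
  ultimately show ?thesis by simp
qed

lemma vnorm_advice_state:
  assumes "j \<in> {1..N - 1}" "\<bar>\<gamma>\<bar> \<le> 1"
  shows "vnorm (advice_state N \<gamma> j) = 1"
proof -
  have g: "\<gamma>\<^sup>2 \<le> 1" using assms(2) by (simp add: abs_square_le_1)
  have "(vnorm (advice_state N \<gamma> j))\<^sup>2 =
      (\<Sum>i<N. (if i = j then \<gamma>\<^sup>2 else 0) + (if i = 0 then 1 - \<gamma>\<^sup>2 else 0))"
    using assms g unfolding vnorm_power2_eq_sum
    by (intro sum.cong) (auto simp: advice_state_def unit_vec_def norm_mult)
  also have "\<dots> = 1"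
  proof -
    have "j < N" "0 < N" using assms(1) by auto
    thus ?thesis by (simp add: sum.distrib)
  qed
  finally show ?thesis using vnorm_nonneg[of "advice_state N \<gamma> j"] by (simp add: power2_eq_1_iff)
qed

text \<open>For unit vectors the squared distance is 2 minus twice the real part of the overlap, so
  a lower bound on the overlap suffices.\<close>

lemma vnorm_start_state_diff_le:
  assumes j: "j \<in> {1..N - 1}" and g: "\<bar>\<gamma>\<bar> \<le> 1" and A: "0 < rest_dim A"
  shows "(vnorm (start_state N t A (advice_state N \<gamma> j) - start_state N t A (unit_vec N 0)))\<^sup>2
           \<le> 2 * (real t * \<gamma>\<^sup>2)"
proof -
  have N: "0 < N" using j by auto
  have g2: "\<gamma>\<^sup>2 \<le> 1" using g by (simp add: abs_square_le_1)
  \<comment> \<open>Bernoulli's inequality for the power of \<open>1 - \<gamma>\<^sup>2\<close>; the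
    passage to its square root then uses \<open>x \<le> sqrt x\<close> on [0, 1].\<close>
  have "1 - real t * \<gamma>\<^sup>2 \<le> (1 - \<gamma>\<^sup>2) ^ t"
    using Bernoulli_inequality[of "- \<gamma>\<^sup>2" t] g2 by simp
  also have "\<dots> \<le> sqrt (1 - \<gamma>\<^sup>2) ^ t"
  proof (rule power_mono)
    show "1 - \<gamma>\<^sup>2 \<le> sqrt (1 - \<gamma>\<^sup>2)"
      using g2 by (intro real_le_rsqrt) (simp add: power2_eq_square mult_left_le)
  qed (use g2 in simp)
  finally have ov: "1 - real t * \<gamma>\<^sup>2 \<le> sqrt (1 - \<gamma>\<^sup>2) ^ t" .
  have "start_state N t A (advice_state N \<gamma> j) \<bullet>c start_state N t A (unit_vec N 0) =
      of_real (sqrt (1 - \<gamma>\<^sup>2) ^ t)"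
    using N A by (simp add: cscalar_prod_start_state advice_state_overlap[OF j])
  moreover have "dim_vec (start_state N t A (advice_state N \<gamma> j)) = dim_vec (start_state N t A (unit_vec N 0))"
    by (simp add: start_state_def)
  ultimately show ?thesis
    using ov vnorm_start_state[OF dim_advice_state N A vnorm_advice_state[OF j g], of t]
      vnorm_start_state[OF _ N A vnorm_unit_vec[OF N], of t]
    by (simp add: vnorm_diff_power2)
qed


section \<open>Measurement statistics\<close>

text \<open>Defined for vectors of any norm, so that it also applies to the difference of two
  states.\<close>

definition outcome_prob :: "algorithm \<Rightarrow> nat \<Rightarrow> complex vec \<Rightarrow> real" where
  "outcome_prob A b v =
     (\<Sum>i \<in> {i. i < length (povm A) \<and> out A i = b}. Re ((povm A ! i *\<^sub>v v) \<bullet>c v))"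

text \<open>
  Expanding \<open>\<langle>w - 2d, E (w - 2d)\<rangle> \<ge> 0\<close> bounds the cross terms, which avoids the Cauchy--Schwarz
  inequality for the form of \<open>E\<close>.
\<close>

lemma psd_mat_add_le:
  assumes E: "psd_mat D E" and w: "w \<in> carrier_vec D" and d: "d \<in> carrier_vec D"
  shows "Re ((E *\<^sub>v (w + d)) \<bullet>c (w + d)) \<le> 3 / 2 * Re ((E *\<^sub>v w) \<bullet>c w) + 3 * Re ((E *\<^sub>v d) \<bullet>c d)"
proof -
  have Ec: "E \<in> carrier_mat D D" using E by (simp add: psd_mat_def)
  define B where "B x y = (E *\<^sub>v x) \<bullet>c y" for x y
  have B: "B x y = (\<Sum>i<D. (\<Sum>k<D. E $$ (i, k) * x $ k) * cnj (y $ i))"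
    if "x \<in> carrier_vec D" "y \<in> carrier_vec D" for x y
    using that Ec unfolding B_def cscalar_prod_eq_sum
    by (auto simp: scalar_prod_def atLeast0LessThan intro!: sum.cong)
  have exp: "B (w + c \<cdot>\<^sub>v d) (w + c \<cdot>\<^sub>v d) = B w w + cnj c * B w d + c * B d w + c * cnj c * B d d" for c
    using w d
    by (simp add: B algebra_simps sum.distrib sum_distrib_left sum_distrib_right)
  \<comment> \<open>This bounds the sum of the two cross terms by half of \<open>B w w\<close> plus
    twice \<open>B d d\<close>; adding the diagonal terms yields the factors 3/2 and 3.\<close>
  have "Re (B (w + (-2) \<cdot>\<^sub>v d) (w + (-2) \<cdot>\<^sub>v d)) \<ge> 0"
    using E w d unfolding B_def psd_mat_def by (auto simp: less_eq_complex_def)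
  moreover have "B (w + d) (w + d) = B (w + 1 \<cdot>\<^sub>v d) (w + 1 \<cdot>\<^sub>v d)" by simp
  ultimately show ?thesis unfolding exp by (simp flip: B_def)
qed

text \<open>The POVM elements sum to the identity, so all outcomes together have weight
  \<open>(vnorm v)\<^sup>2\<close>; distinct outputs come from disjoint sets of outcomes.\<close>

lemma outcome_prob_sum_le:
  assumes P: "is_povm D (povm A)" and v: "v \<in> carrier_vec D" and "b \<noteq> b'"
  shows "outcome_prob A b v + outcome_prob A b' v \<le> (vnorm v)\<^sup>2"
proof -
  have sum: "foldr (+) Es (0\<^sub>m D D) \<in> carrier_mat D D \<and>
      (\<Sum>i<length Es. Re ((Es ! i *\<^sub>v v) \<bullet>c v)) = Re ((foldr (+) Es (0\<^sub>m D D) *\<^sub>v v) \<bullet>c v)"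
    if "\<forall>E\<in>set Es. psd_mat D E" for Es
    using that
  proof (induction Es)
    case Nil
    have "0\<^sub>m D D *\<^sub>v v = 0\<^sub>v D" using v by auto
    thus ?case using v by simp
  next
    case (Cons E Es)
    have E: "E \<in> carrier_mat D D" using Cons.prems by (simp add: psd_mat_def)
    let ?F = "foldr (+) Es (0\<^sub>m D D)"
    have F: "?F \<in> carrier_mat D D" using Cons by simp
    have "(E + ?F) *\<^sub>v v = E *\<^sub>v v + ?F *\<^sub>v v"
      using E F v by (rule add_mult_distrib_mat_vec)
    moreover have "(E *\<^sub>v v + ?F *\<^sub>v v) \<bullet>c v = (E *\<^sub>v v) \<bullet>c v + (?F *\<^sub>v v) \<bullet>c v"
      using E F v by (intro add_scalar_prod_distrib[of _ D]) auto
    ultimately show ?case using Cons E unfolding length_Cons sum.lessThan_Suc_shift by simp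
  qed
  have nonneg: "0 \<le> Re ((povm A ! i *\<^sub>v v) \<bullet>c v)" if "i < length (povm A)" for i
    using P v that unfolding is_povm_def psd_mat_def by (auto simp: less_eq_complex_def)
  have "outcome_prob A b v + outcome_prob A b' v =
      (\<Sum>i \<in> {i. i < length (povm A) \<and> out A i = b} \<union> {i. i < length (povm A) \<and> out A i = b'}.
         Re ((povm A ! i *\<^sub>v v) \<bullet>c v))"
    unfolding outcome_prob_def using \<open>b \<noteq> b'\<close> by (subst sum.union_disjoint) auto
  also have "\<dots> \<le> (\<Sum>i<length (povm A). Re ((povm A ! i *\<^sub>v v) \<bullet>c v))"
    using nonneg by (intro sum_mono2) auto
  also have "\<dots> = (vnorm v)\<^sup>2"
    using sum[of "povm A"] P v by (simp add: is_povm_def cscalar_prod_self)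
  finally show ?thesis .
qed

lemma outcome_prob_nonneg:
  assumes "is_povm D (povm A)" "v \<in> carrier_vec D"
  shows "0 \<le> outcome_prob A b v"
  unfolding outcome_prob_def using assms
  by (intro sum_nonneg) (auto simp: is_povm_def psd_mat_def less_eq_complex_def)

lemma outcome_prob_add_le:
  assumes P: "is_povm D (povm A)" and w: "w \<in> carrier_vec D" and d: "d \<in> carrier_vec D"
  shows "outcome_prob A b (w + d) \<le> 3 / 2 * outcome_prob A b w + 3 * (vnorm d)\<^sup>2"
proof -
  have "outcome_prob A b (w + d) \<le> 3 / 2 * outcome_prob A b w + 3 * outcome_prob A b d"
    unfolding outcome_prob_def sum_distrib_left sum.distrib[symmetric]
    using P w d by (intro sum_mono psd_mat_add_le) (auto simp: is_povm_def)
  \<comment> \<open>\<open>Suc b\<close> serves as a second output, whose weight is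
    nonnegative.\<close>
  moreover have "outcome_prob A b d \<le> (vnorm d)\<^sup>2"
    using outcome_prob_sum_le[OF P d n_not_Suc_n[of b]] outcome_prob_nonneg[OF P d, of "Suc b"]
    by simp
  ultimately show ?thesis by simp
qed

text \<open>On \<open>w\<close>, output 1 has probability at most 1/3, so 2/3 is at most 1/2 plus
  three times the squared distance.\<close>

lemma distinguishable_far_apart:
  assumes P: "is_povm D (povm A)" and v: "v \<in> carrier_vec D" and w: "w \<in> carrier_vec D"
    and "vnorm w = 1" "outcome_prob A 1 v \<ge> 2 / 3" "outcome_prob A 0 w \<ge> 2 / 3"
  shows "1 / 18 \<le> (vnorm (w - v))\<^sup>2"
proof -
  have "w + (v - w) = v" using v w by auto
  hence "2 / 3 \<le> 3 / 2 * outcome_prob A 1 w + 3 * (vnorm (v - w))\<^sup>2"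
    using outcome_prob_add_le[OF P w, of "v - w" 1] v w assms(5) by simp
  moreover have "outcome_prob A 1 w \<le> 1 / 3"
    using outcome_prob_sum_le[OF P w, of 0 1] assms(4,6) by simp
  moreover have "vnorm (v - w) = vnorm (w - v)"
    using v w by (auto simp: vnorm_def norm_minus_commute intro!: L2_set_cong)
  ultimately show ?thesis by simp
qed


section \<open>The lower bound\<close>

text \<open>The bound for fixed parameters with explicit constants; 1/200 is the threshold that
  keeps the starting distance within 1/10.\<close>

lemma solves_frOR_cost_ge:
  assumes N: "N \<ge> 2" and g: "\<bar>\<gamma>\<bar> \<le> 1" and d: "\<delta> > 0"
    and t: "real t * \<gamma>\<^sup>2 \<le> 1 / 200"
    and sol: "solves_frOR N \<delta> t \<gamma> A"
  shows "real (cost A) \<ge> 1 / 20 * sqrt (real N) / \<delta>"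
proof -
  let ?D = "total_dim N t A"
  let ?S = "{1..N - 1}"
  have A: "0 < rest_dim A" and valid: "\<forall>s\<in>set (steps A). valid_step N t A s"
    and P: "is_povm ?D (povm A)"
    using sol by (auto simp: solves_frOR_def valid_algorithm_def)
  define v where "v = start_state N t A (unit_vec N 0)"
  have v: "v \<in> carrier_vec ?D" "vnorm v = 1"
    using N A by (auto simp: v_def start_state_carrier vnorm_start_state vnorm_unit_vec)
  have prob: "prob_output N t A U a b = outcome_prob A b (run N t A U (steps A) (start_state N t A a))"
    for U a b
    by (simp add: prob_output_def outcome_prob_def final_state_def run_def Let_def)
  let ?q = "\<lambda>j. query_weight N t A j (steps A) v"
  \<comment> \<open>The final distance is at least 1/5 and the starting distance at most 1/10; the
    queries must account for the rest.\<close>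
  have weight: "1 / 10 \<le> \<delta> * ?q j" if j: "j \<in> ?S" for j
  proof -
    define w where "w = start_state N t A (advice_state N \<gamma> j)"
    have w: "w \<in> carrier_vec ?D" "vnorm w = 1"
      using N A vnorm_advice_state[OF j g] by (auto simp: w_def start_state_carrier vnorm_start_state)
    let ?e = "vnorm (run N t A (frac_phase N j \<delta>) (steps A) w - run N t A (1\<^sub>m N) (steps A) v)"
    have "1 / 18 \<le> ?e\<^sup>2"
    proof (rule distinguishable_far_apart[OF P])
      show "run N t A (1\<^sub>m N) (steps A) v \<in> carrier_vec ?D"
        using run_carrier[OF valid v(1), of 0 0] by (simp add: frac_phase_zero)
      show "run N t A (frac_phase N j \<delta>) (steps A) w \<in> carrier_vec ?D"
        by (rule run_carrier[OF valid w(1)])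
      show "vnorm (run N t A (frac_phase N j \<delta>) (steps A) w) = 1"
        using vnorm_run[OF valid w(1)] w(2) by simp
    qed (use sol j in \<open>auto simp: solves_frOR_def prob v_def w_def\<close>)
    \<comment> \<open>1/18 exceeds 1/25.\<close>
    hence "(1 / 5)\<^sup>2 \<le> ?e\<^sup>2" by (simp add: power2_eq_square)
    hence "1 / 5 \<le> ?e" by (rule power2_le_imp_le) (rule vnorm_nonneg)
    also have "\<dots> \<le> vnorm (w - v) + \<delta> * ?q j"
      using vnorm_run_diff_le[OF valid v(1) w(1), of j \<delta>] d by simp
    also have "vnorm (w - v) \<le> 1 / 10"
    proof (rule power2_le_imp_le)
      show "(vnorm (w - v))\<^sup>2 \<le> (1 / 10)\<^sup>2"
        using vnorm_start_state_diff_le[OF j g A, of t] t by (simp add: v_def w_def power2_eq_square)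
    qed simp
    finally show ?thesis by simp
  qed
  \<comment> \<open>Summing over all \<open>j\<close> replaces the choice of a good one: the lower
    bound is linear in \<open>N - 1\<close>, the upper bound has only its square root.\<close>
  have "real (N - 1) * (1 / 10) \<le> (\<Sum>j\<in>?S. \<delta> * ?q j)"
    using sum_mono[of ?S "\<lambda>_. 1 / 10" "\<lambda>j. \<delta> * ?q j"] weight by simp
  also have "\<dots> \<le> \<delta> * (real (cost A) * sqrt (real (N - 1)))"
    using sum_query_weight_le[OF valid v(1), of ?S] v(2) d
    by (simp add: sum_distrib_left[symmetric] cost_def)
  finally have "sqrt (real (N - 1)) * (sqrt (real (N - 1)) * (1 / 10)) \<le>
      sqrt (real (N - 1)) * (\<delta> * real (cost A))"
    by (simp add: ac_simps)
  hence "sqrt (real (N - 1)) * (1 / 10) \<le> \<delta> * real (cost A)"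
    using N by (subst (asm) mult_le_cancel_left_pos) auto
  \<comment> \<open>For \<open>N \<ge> 2\<close>, \<open>N\<close> is at most
    \<open>4 * (N - 1)\<close>; the resulting factor 2 turns 1/10 into 1/20.\<close>
  moreover have "sqrt (real N) \<le> sqrt (4 * real (N - 1))"
    using N by (intro real_sqrt_le_mono) (simp add: of_nat_diff)
  ultimately have "1 / 20 * sqrt (real N) \<le> real (cost A) * \<delta>"
    by (simp add: real_sqrt_mult mult.commute)
  thus ?thesis using d by (simp add: pos_divide_le_eq)
qed

theorem theorem3p2:
  fixes N t :: "nat \<Rightarrow> nat" and \<gamma> \<delta> :: "nat \<Rightarrow> real"
  assumes "\<And>n. n \<ge> 1 \<Longrightarrow> N n \<ge> 2"
    and "\<And>n. n \<ge> 1 \<Longrightarrow> \<gamma> n \<in> {1 / sqrt (real (N n))..1}"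
    and "\<And>n. n \<ge> 1 \<Longrightarrow> \<delta> n \<in> {0<..<1}"
    and "(\<lambda>n. real (t n) * (\<gamma> n)\<^sup>2) \<longlonglongrightarrow> 0"
  shows "\<exists>c>0. \<exists>n0\<ge>1. \<forall>n\<ge>n0. \<forall>A. solves_frOR (N n) (\<delta> n) (t n) (\<gamma> n) A \<longrightarrow>
           real (cost A) \<ge> c * sqrt (real (N n)) / \<delta> n"
proof -
  have "eventually (\<lambda>n. real (t n) * (\<gamma> n)\<^sup>2 < 1 / 200) sequentially"
    using assms(4) by (rule order_tendstoD) simp
  then obtain n1 where n1: "\<And>n. n \<ge> n1 \<Longrightarrow> real (t n) * (\<gamma> n)\<^sup>2 < 1 / 200"
    by (auto simp: eventually_sequentially)
  have "real (cost A) \<ge> 1 / 20 * sqrt (real (N n)) / \<delta> n"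
    if n: "n \<ge> max 1 n1" and "solves_frOR (N n) (\<delta> n) (t n) (\<gamma> n) A" for n A
  proof (rule solves_frOR_cost_ge)
    \<comment> \<open>The lower end of the range of \<open>\<gamma> n\<close> makes it nonnegative,
      which gives the bound on its absolute value.\<close>
    have "0 \<le> 1 / sqrt (real (N n))" by simp
    thus "\<bar>\<gamma> n\<bar> \<le> 1" using assms(2)[of n, unfolded atLeastAtMost_iff] n unfolding abs_le_iff by linarith
    show "real (t n) * (\<gamma> n)\<^sup>2 \<le> 1 / 200" using n1[of n] n by simp
  qed (use assms(1,3)[of n] that in auto)
  thus ?thesis
    by (intro exI[of _ "1 / 20"] conjI exI[of _ "max 1 n1"]) auto
qed

end
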